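(* Let $n\ge 1$. Every symmetric tropical polynomial $p\in \operatorname{Trop}[x_1,\ldots,x_n]$ can be written as a tropical polynomial in the elementary symmetric tropical polynomials $e_1,\ldots,e_n$ and $e_n^{-1}$. That is, $p$ equals, as a function of $(x_1,\ldots,x_n)$, a finite tropical sum of terms of the form $a\odot e_1^{m_1}\odot\cdots\odot e_n^{m_n}\odot (e_n^{-1})^{m}$ with $a\in\mathbb{R}$ and $m_1,\ldots,m_n,m$ nonnegative integers.
   Context: Tropical arithmetic: $a\oplus b=\min(a,b)$, $a\odot b=a+b$; $b^{-1}$ denotes $-b$ (tropical inverse), and $x^i$ is the tropical power (ordinary $i\cdot x$). A tropical polynomial expression in $x_1,\ldots,x_n$ is a finite (nonempty) tropical sum $\bigoplus_{j=1}^m a_j\odot x_1^{i_1^j}\odot\cdots\odot x_n^{i_n^j}$ with $a_j\in\mathbb{R}$ and exponents $i_k^j\in\mathbb{Z}$ (negative exponents are allowed); it defines the function $x\mapsto\min_j(a_j+i_1^jx_1+\cdots+i_n^jx_n)$ on $\mathbb{R}^n$. Two expressions are functionally equivalent if they define the same function. $\operatorname{Trop}[x_1,\ldots,x_n]$ is the semiring of equivalence classes of tropical polynomial expressions under functional equivalence; its elements are called tropical polynomials. A tropical polynomial $p$ is symmetric if $p(x_1,\ldots,x_n)=p(x_{\pi(1)},\ldots,x_{\pi(n)})$ for every $\pi\in S_n$. The elementary symmetric tropical polynomials are $e_k=\bigoplus_{\pi\in S_n}x_{\pi(1)}\odot\cdots\odot x_{\pi(k)}$ for $1\le k\le n$ (the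 minimum over all $k$-element subsets of the sum of the corresponding variables); in particular $e_n=x_1\odot\cdots\odot x_n$. *)

theory Defs
  imports Complex_Main "HOL-Combinatorics.Permutations"
begin

text \<open>
  A point of $R^n$ is given by the coordinates \<open>x 1, \<dots>, x n\<close> of some
  \<open>x :: nat \<Rightarrow> real\<close>; the other coordinates never influence the functions below.
  Tropical sums are minima, tropical products are sums, and the tropical power
  with exponent \<open>i\<close> is multiplication by \<open>i\<close>.
\<close>

definition trop_monomial :: "nat \<Rightarrow> real \<Rightarrow> (nat \<Rightarrow> int) \<Rightarrow> (nat \<Rightarrow> real) \<Rightarrow> real" where
  "trop_monomial n a i x = a + (\<Sum>k = 1..n. of_int (i k) * x k)"

text \<open>
  A tropical polynomial expression is a finite nonempty set of pairs of a coefficient and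
  an exponent vector; repeated terms can be dropped since \<open>min\<close> is idempotent.
\<close>

type_synonym trop_expr = "(real \<times> (nat \<Rightarrow> int)) set"

definition is_trop_expr :: "trop_expr \<Rightarrow> bool" where
  "is_trop_expr T \<longleftrightarrow> finite T \<and> T \<noteq> {}"

definition trop_fun :: "nat \<Rightarrow> trop_expr \<Rightarrow> (nat \<Rightarrow> real) \<Rightarrow> real" where
  "trop_fun n T x = (MIN (a, i) \<in> T. trop_monomial n a i x)"

text \<open>
  A class of expressions under functional equivalence is represented by the function that
  its members define.
\<close>

definition Trop :: "nat \<Rightarrow> ((nat \<Rightarrow> real) \<Rightarrow> real) set" where
  "Trop n = {trop_fun n T | T. is_trop_expr T}"

definition trop_symmetric :: "nat \<Rightarrow> ((nat \<Rightarrow> real) \<Rightarrow> real) \<Rightarrow> bool" where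
  "trop_symmetric n p \<longleftrightarrow> (\<forall>\<pi>. \<pi> permutes {1..n} \<longrightarrow> (\<forall>x. p x = p (\<lambda>i. x (\<pi> i))))"

definition trop_elem :: "nat \<Rightarrow> nat \<Rightarrow> (nat \<Rightarrow> real) \<Rightarrow> real" where
  "trop_elem n k x = (MIN \<pi> \<in> {\<pi>. \<pi> permutes {1..n}}. \<Sum>i = 1..k. x (\<pi> i))"

end

theory Submission
  imports Defs
begin

text \<open>
  Sort the exponents of every term of an expression of \<open>p\<close> in descending order, say to \<open>c\<close>.
  Summation by parts writes \<open>\<Sum>k. c k * z k\<close> as a combination of the partial sums of \<open>z\<close> with
  the nonnegative coefficients \<open>c k - c (k + 1)\<close> and the coefficient \<open>c n\<close> of arbitrary sign
  at \<open>\<Sum>k. z k\<close>. Replacing the partial sums by the \<open>e\<^sub>k\<close> gives a term in the \<open>e\<^sub>k\<close> and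
  the inverse of \<open>e\<^sub>n\<close>. As \<open>e\<^sub>k\<close> is the least partial sum over all reorderings of \<open>x\<close>, this
  term bounds the original one from below at every point; at the ascending reordering of \<open>x\<close>, where all
  \<open>e\<^sub>k\<close> are attained at once, it equals the original term at a reordering of \<open>x\<close>, hence is
  at least \<open>p x\<close> by symmetry.
\<close>

text \<open>Selection sort: a transposition moves a position of the maximum to the end, and the
  induction hypothesis sorts the positions before it.\<close>

lemma sorting_permutation_exists:
  fixes f :: "nat \<Rightarrow> 'a :: linorder"
  shows "\<exists>\<pi>. \<pi> permutes {1..n} \<and> mono_on {1..n} (f \<circ> \<pi>)"
proof (induction n arbitrary: f)
  case 0
  show ?case by (intro exI[of _ id] conjI permutes_id) (simp add: monotone_on_def)
next
  case (Suc n)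
  have "Max (f ` {1..Suc n}) \<in> f ` {1..Suc n}"
    by (intro Max_in) auto
  then obtain m where m: "m \<in> {1..Suc n}" and "f m = Max (f ` {1..Suc n})"
    by (metis imageE)
  then have max: "f k \<le> f m" if "k \<in> {1..Suc n}" for k
    using that by simp
  let ?t = "transpose m (Suc n)"
  from Suc.IH obtain \<pi> where \<pi>: "\<pi> permutes {1..n}" and mono: "mono_on {1..n} ((f \<circ> ?t) \<circ> \<pi>)"
    by blast
  have "\<pi> permutes {1..Suc n}"
    by (rule permutes_subset[OF \<pi>]) auto
  then have perm: "?t \<circ> \<pi> permutes {1..Suc n}"
    using m by (intro permutes_compose permutes_swap_id) auto
  have last: "(?t \<circ> \<pi>) (Suc n) = m"
    using permutes_not_in[OF \<pi>] by simp
  have "f ((?t \<circ> \<pi>) r) \<le> f ((?t \<circ> \<pi>) s)"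
    if "r \<in> {1..Suc n}" "s \<in> {1..Suc n}" "r \<le> s" for r s
  proof (cases "s = Suc n")
    case True
    then show ?thesis
      using max permutes_in_image[OF perm] that(1) last by metis
  next
    case False
    then show ?thesis
      using that mono_onD[OF mono, of r s] by simp
  qed
  then have "mono_on {1..Suc n} (f \<circ> (?t \<circ> \<pi>))"
    by (auto intro!: mono_onI)
  with perm show ?case by blast
qed

text \<open>The indices common to \<open>{1..k}\<close> and its image cancel. Those left over are
  equally many on both sides, and \<open>y k\<close> separates their values: they are at most
  \<open>k\<close> on the left and above \<open>k\<close> on the right.\<close>

lemma sum_initial_le_sum_permuted:
  fixes y :: "nat \<Rightarrow> real"
  assumes mono: "mono_on {1..n} y" and \<pi>: "\<pi> permutes {1..n}" and k: "k \<le> n"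
  shows "(\<Sum>i = 1..k. y i) \<le> (\<Sum>i = 1..k. y (\<pi> i))"
proof -
  let ?K = "{1..k}"
  let ?A = "\<pi> ` ?K"
  have inj: "inj_on \<pi> ?K"
    using permutes_inj[OF \<pi>] by (rule inj_on_subset) simp
  have A: "?A \<subseteq> {1..n}"
    using k image_mono[of ?K "{1..n}" \<pi>] unfolding permutes_image[OF \<pi>] by simp
  have "card (?K - ?A) = card (?A - ?K)"
    using card_image[OF inj] by (simp add: card_Diff_subset_Int Int_commute)
  then have "(\<Sum>i\<in>?K - ?A. y k) = (\<Sum>i\<in>?A - ?K. y k)"
    by simp
  moreover have "sum y (?K - ?A) \<le> (\<Sum>i\<in>?K - ?A. y k)"
    using k by (intro sum_mono mono_onD[OF mono]) auto
  moreover have "(\<Sum>i\<in>?A - ?K. y k) \<le> sum y (?A - ?K)"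
  \<comment> \<open>For \<open>k = 0\<close> the index \<open>k\<close> lies outside
    \<open>{1..n}\<close>, so monotonicity says nothing about \<open>y k\<close>; but then
    \<open>?A\<close> is empty.\<close>
  proof (cases "k = 0")
    case False
    with k A show ?thesis by (intro sum_mono mono_onD[OF mono]) auto
  qed simp
  moreover have "sum y ?K = sum y (?K \<inter> ?A) + sum y (?K - ?A)"
    by (rule sum.Int_Diff) simp
  moreover have "sum y ?A = sum y (?K \<inter> ?A) + sum y (?A - ?K)"
    by (subst Int_commute, rule sum.Int_Diff) simp
  ultimately have "sum y ?K \<le> sum y ?A"
    by linarith
  also have "sum y ?A = (\<Sum>i = 1..k. y (\<pi> i))"
    by (simp only: sum.reindex[OF inj] comp_def)
  finally show ?thesis .
qed

lemma trop_elem_le: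
  assumes "\<pi> permutes {1..n}"
  shows "trop_elem n k x \<le> (\<Sum>i = 1..k. x (\<pi> i))"
  unfolding trop_elem_def using assms by (intro Min_le) (auto simp: finite_permutations)

lemma trop_elem_eq_sum_sorted:
  assumes \<tau>: "\<tau> permutes {1..n}" and mono: "mono_on {1..n} (x \<circ> \<tau>)" and k: "k \<le> n"
  shows "trop_elem n k x = (\<Sum>i = 1..k. x (\<tau> i))"
  unfolding trop_elem_def
proof (rule Min_eqI)
  fix s
  assume "s \<in> (\<lambda>\<pi>. \<Sum>i = 1..k. x (\<pi> i)) ` {\<pi>. \<pi> permutes {1..n}}"
  then obtain \<pi> where \<pi>: "\<pi> permutes {1..n}" and s: "s = (\<Sum>i = 1..k. x (\<pi> i))"
    by auto
  \<comment> \<open>Reordering the sorted \<open>x \<circ> \<tau>\<close> by this permutation gives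
    \<open>x \<circ> \<pi>\<close>.\<close>
  have "inv \<tau> \<circ> \<pi> permutes {1..n}"
    using \<pi> permutes_inv[OF \<tau>] by (rule permutes_compose)
  from sum_initial_le_sum_permuted[OF mono this k]
  show "(\<Sum>i = 1..k. x (\<tau> i)) \<le> s"
    by (simp add: s permutes_inverses(1)[OF \<tau>])
qed (use \<tau> in \<open>auto simp: finite_permutations\<close>)

lemma trop_elem_last:
  assumes "\<pi> permutes {1..n}"
  shows "trop_elem n n x = (\<Sum>i = 1..n. x (\<pi> i))"
proof -
  obtain \<tau> where \<tau>: "\<tau> permutes {1..n}" "mono_on {1..n} (x \<circ> \<tau>)"
    using sorting_permutation_exists by blast
  have "trop_elem n n x = (\<Sum>i = 1..n. x (\<tau> i))"
    by (rule trop_elem_eq_sum_sorted[OF \<tau>]) simp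
  then show ?thesis
    using sum.permute[OF \<tau>(1), of x] sum.permute[OF assms, of x] by (simp add: comp_def)
qed

lemma summation_by_parts:
  fixes c z :: "nat \<Rightarrow> real"
  assumes "n \<ge> 1"
  shows "(\<Sum>k = 1..n. c k * z k) =
    (\<Sum>k = 1..<n. (c k - c (Suc k)) * (\<Sum>i = 1..k. z i)) + c n * (\<Sum>i = 1..n. z i)"
  using assms
proof (induction n rule: dec_induct)
  case (step n)
  then show ?case by (simp add: algebra_simps)
qed simp

text \<open>For descending \<open>c\<close>, \<open>nat\<close> loses nothing at
  \<open>k < n\<close>. At \<open>n\<close> it keeps only the positive part of \<open>c n\<close>;
  the negative part \<open>nat (- c n)\<close> becomes the exponent of the inverse of
  \<open>e\<^sub>n\<close>.\<close>

definition elem_exponent :: "nat \<Rightarrow> (nat \<Rightarrow> int) \<Rightarrow> nat \<Rightarrow> nat" where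
  "elem_exponent n c k = (if k < n then nat (c k - c (Suc k)) else nat (c n))"

lemma sum_elem_exponent:
  fixes z :: "nat \<Rightarrow> real"
  assumes n: "n \<ge> 1" and c: "antimono_on {1..n} c"
  shows "(\<Sum>k = 1..n. of_int (c k) * z k) =
    (\<Sum>k = 1..n. real (elem_exponent n c k) * (\<Sum>i = 1..k. z i))
      + real (nat (- c n)) * (- (\<Sum>i = 1..n. z i))"
proof -
  have "real (elem_exponent n c k) = of_int (c k) - of_int (c (Suc k))" if "k \<in> {1..<n}" for k
    using that monotone_onD[OF c, of k "Suc k"] by (simp add: elem_exponent_def)
  then have "(\<Sum>k = 1..<n. real (elem_exponent n c k) * (\<Sum>i = 1..k. z i)) =
      (\<Sum>k = 1..<n. (of_int (c k) - of_int (c (Suc k))) * (\<Sum>i = 1..k. z i))"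
    by simp
  moreover have "{1..n} = insert n {1..<n}"
    using n by auto
  then have "(\<Sum>k = 1..n. real (elem_exponent n c k) * (\<Sum>i = 1..k. z i)) =
      real (elem_exponent n c n) * (\<Sum>i = 1..n. z i)
        + (\<Sum>k = 1..<n. real (elem_exponent n c k) * (\<Sum>i = 1..k. z i))"
    by (simp only: sum.insert finite_atLeastLessThan atLeastLessThan_iff less_irrefl simp_thms)
  moreover have "of_int (c n) = real (elem_exponent n c n) - real (nat (- c n))"
    by (simp add: elem_exponent_def)
  then have "of_int (c n) * (\<Sum>i = 1..n. z i) =
      real (elem_exponent n c n) * (\<Sum>i = 1..n. z i) - real (nat (- c n)) * (\<Sum>i = 1..n. z i)"
    by (simp only: left_diff_distrib)
  ultimately show ?thesis
    using summation_by_parts[OF n, of "\<lambda>k. of_int (c k)" z] by linarith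
qed

lemma trop_fun_le:
  assumes "is_trop_expr T" and "(a, i) \<in> T"
  shows "trop_fun n T x \<le> trop_monomial n a i x"
  unfolding trop_fun_def using assms
  by (intro Min_le) (auto simp: is_trop_expr_def image_iff intro!: bexI[of _ "(a, i)"])

lemma trop_fun_attained:
  assumes "is_trop_expr T"
  obtains a i where "(a, i) \<in> T" and "trop_fun n T x = trop_monomial n a i x"
proof -
  have "trop_fun n T x \<in> (\<lambda>(a, i). trop_monomial n a i x) ` T"
    unfolding trop_fun_def using assms by (intro Min_in) (auto simp: is_trop_expr_def)
  with that show thesis by auto
qed

theorem theorem3p7:
  fixes n :: nat and p :: "(nat \<Rightarrow> real) \<Rightarrow> real"
  assumes "n \<ge> 1" and "p \<in> Trop n" and "trop_symmetric n p"
  shows "\<exists>T :: (real \<times> (nat \<Rightarrow> nat) \<times> nat) set. finite T \<and> T \<noteq> {} \<and>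
    (\<forall>x. p x = (MIN (a, m, m') \<in> T.
       a + (\<Sum>k = 1..n. real (m k) * trop_elem n k x) + real m' * (- trop_elem n n x)))"
proof -
  from assms(2) obtain T where T: "is_trop_expr T" and p: "p = trop_fun n T"
    by (auto simp: Trop_def)
  have "\<exists>\<sigma>. \<sigma> permutes {1..n} \<and> antimono_on {1..n} (i \<circ> \<sigma>)" for i :: "nat \<Rightarrow> int"
    \<comment> \<open>Negation turns the ascending order into the descending one.\<close>
    using sorting_permutation_exists[of n "\<lambda>k. - i k"] by (auto simp: monotone_on_def)
  then obtain \<sigma> :: "(nat \<Rightarrow> int) \<Rightarrow> nat \<Rightarrow> nat" where
    \<sigma>: "\<sigma> i permutes {1..n}" and anti: "antimono_on {1..n} (i \<circ> \<sigma> i)" for i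
    by metis
  define term_of :: "real \<times> (nat \<Rightarrow> int) \<Rightarrow> real \<times> (nat \<Rightarrow> nat) \<times> nat" where
    "term_of = (\<lambda>(a, i). (a, elem_exponent n (i \<circ> \<sigma> i), nat (- i (\<sigma> i n))))"
  define h :: "real \<times> (nat \<Rightarrow> nat) \<times> nat \<Rightarrow> (nat \<Rightarrow> real) \<Rightarrow> real" where
    "h = (\<lambda>(a, m, m') x.
      a + (\<Sum>k = 1..n. real (m k) * trop_elem n k x) + real m' * (- trop_elem n n x))"
  \<comment> \<open>The full sum in the inverse factor is already replaced by
    \<open>e\<^sub>n\<close>, which is possible since all reorderings share that sum. The partial
    sums that remain have nonnegative coefficients, so bounding them below by the
    \<open>e\<^sub>k\<close> bounds the whole term below.\<close>
  have monomial: "trop_monomial n a i x =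
      a + (\<Sum>k = 1..n. real (elem_exponent n (i \<circ> \<sigma> i) k) * (\<Sum>j = 1..k. x (\<sigma> i j)))
        + real (nat (- i (\<sigma> i n))) * (- trop_elem n n x)" for a i x
    using sum_elem_exponent[OF assms(1) anti, of i "\<lambda>k. x (\<sigma> i k)"]
      sum.permute[OF \<sigma>, of "\<lambda>k. of_int (i k) * x k" i] trop_elem_last[OF \<sigma>, of x i]
    by (simp add: trop_monomial_def comp_def)
  have lower: "h (term_of (a, i)) x \<le> trop_monomial n a i x" for a i x
    unfolding monomial
    by (auto simp: h_def term_of_def simp del: One_nat_def intro!: sum_mono mult_left_mono trop_elem_le \<sigma>)
  have upper: "p x \<le> h (term_of (a, i)) x" if "(a, i) \<in> T" for a i x
  proof -
    obtain \<tau> where \<tau>: "\<tau> permutes {1..n}" "mono_on {1..n} (x \<circ> \<tau>)"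
      using sorting_permutation_exists by blast
    \<comment> \<open>Chosen so that \<open>?\<rho> \<circ> \<sigma> i = \<tau>\<close>: the term
      then pairs its largest exponents with the smallest coordinates of \<open>x\<close>, and its
      partial sums are exactly the \<open>e\<^sub>k\<close>.\<close>
    let ?\<rho> = "\<tau> \<circ> inv (\<sigma> i)"
    have \<rho>: "?\<rho> permutes {1..n}"
      using permutes_inv[OF \<sigma>] \<tau>(1) by (rule permutes_compose)
    have "p x = p (\<lambda>k. x (?\<rho> k))"
      using assms(3) \<rho> unfolding trop_symmetric_def by blast
    also have "\<dots> \<le> trop_monomial n a i (\<lambda>k. x (?\<rho> k))"
      unfolding p using T that by (rule trop_fun_le)
    also have "\<dots> = h (term_of (a, i)) x"
    proof -
      have "trop_elem n n (\<lambda>k. x (?\<rho> k)) = trop_elem n n x"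
        using trop_elem_last[OF \<sigma>, of "\<lambda>k. x (?\<rho> k)" i] trop_elem_last[OF \<tau>(1), of x]
        by (simp add: permutes_inverses(2)[OF \<sigma>])
      then show ?thesis
        unfolding monomial
        by (simp add: h_def term_of_def permutes_inverses(2)[OF \<sigma>]
            trop_elem_eq_sum_sorted[OF \<tau>])
    qed
    finally show ?thesis .
  qed
  have "p x = (MIN t \<in> term_of ` T. h t x)" for x
  proof (rule sym, rule Min_eqI)
    show "finite ((\<lambda>t. h t x) ` term_of ` T)"
      using T by (simp add: is_trop_expr_def)
    show "p x \<le> y" if "y \<in> (\<lambda>t. h t x) ` term_of ` T" for y
      using that upper by auto
    \<comment> \<open>At a term of \<open>T\<close> that attains the minimum at \<open>x\<close>,
      the two bounds meet.\<close>
    obtain a i where ai: "(a, i) \<in> T" "p x = trop_monomial n a i x"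
      using trop_fun_attained[OF T] p by metis
    then have "p x = h (term_of (a, i)) x"
      using upper[OF ai(1), of x] lower[of a i x] by simp
    with ai(1) show "p x \<in> (\<lambda>t. h t x) ` term_of ` T"
      by blast
  qed
  moreover have "finite (term_of ` T)" "term_of ` T \<noteq> {}"
    using T by (auto simp: is_trop_expr_def)
  ultimately show ?thesis
    by (intro exI[of _ "term_of ` T"]) (simp add: h_def case_prod_unfold)
qed

end
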